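(* Let $G_1, G_2$ be groups and $G := G_1 \oplus G_2$. Let $x_1,\ldots,x_n, x_1',\ldots,x_n', y_1,\ldots,y_m, y_1',\ldots,y_m' \in G_1$ and $z_1,\ldots,z_m \in G_2$, and set \begin{align*} F_1 &:= ((x_1,1),\ldots,(x_n,1),(y_1,z_1),\ldots,(y_m,z_m)),\\ F_2 &:= ((x_1',1),\ldots,(x_n',1),(y_1',z_1),\ldots,(y_m',z_m)),\\ K &:= \langle x_1,\ldots,x_n,y_1,\ldots,y_m\rangle \le G_1, \end{align*} and let $N$ be the normal closure of $\{x_1,\ldots,x_n\}$ inside $K$. \begin{enumerate} \item If $F_1 \cong_H F_2$ and $z_i \neq 1$ for all $i$, then there exists a permutation $\pi \in S_n$ such that for every $i$, $1\le i\le n$, $x_i'$ is conjugate to $x_{\pi(i)}$ in $K$ (in particular $x_i' \in N$). \item If in addition the stabilizer in $B_m$ (under the Hurwitz braid action) of $(z_1,\ldots,z_m)$ is contained in the stabilizer in $B_m$ of $(y_1,\ldots,y_m)$, then for every $i$, $1\le i\le m$, there exists an element $m_i\in N$ such that $y_i' = y_i^{m_i}$. \end{enumerate}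
   Context: For a group $G$, a $g$-factorization of length $n$ is a tuple $(f_1,\ldots,f_n)\in G^n$ with $f_1\cdots f_n=g$. The braid group $B_n$ (generators $\sigma_1,\ldots,\sigma_{n-1}$) acts on the right on factorizations of length $n$ by the Hurwitz braid action: $(f_1,\ldots,f_n)\sigma_i = (f_1,\ldots,f_{i-1},f_{i+1},f_{i+1}^{-1}f_if_{i+1},f_{i+2},\ldots,f_n)$ and $(f_1,\ldots,f_n)\sigma_i^{-1} = (f_1,\ldots,f_{i-1},f_if_{i+1}f_i^{-1},f_i,f_{i+2},\ldots,f_n)$. Two factorizations are Hurwitz equivalent, written $\cong_H$, if they lie in the same orbit of this action. Conjugation convention: $a^b = b^{-1}ab$. Here $F_1, F_2$ are factorizations in $G_1\oplus G_2$ with componentwise multiplication, acted on by $B_{n+m}$. *)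

theory Defs
  imports "HOL-Algebra.Algebra"
begin

section \<open>Braid groups\<close>

text \<open>
  Braid generators are numbered from 0, in line with list positions: the letter \<open>(i, True)\<close>
  stands for the generator called $\sigma_{i+1}$ in the usual numbering, and \<open>(i, False)\<close> for
  its inverse. The group on \<open>n\<close> strands has the generators with \<open>Suc i < n\<close>; it is trivial
  for \<open>n \<le> 1\<close>.
\<close>

type_synonym braid_word = "(nat \<times> bool) list"

definition braid_words :: "nat \<Rightarrow> braid_word set" where
  "braid_words n = lists ({i. Suc i < n} \<times> UNIV)"

text \<open>The congruence generated by free cancellation and Artin's relations.\<close>

inductive braid_cong :: "nat \<Rightarrow> braid_word \<Rightarrow> braid_word \<Rightarrow> bool" for n where
  refl: "w \<in> braid_words n \<Longrightarrow> braid_cong n w w"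
| sym: "braid_cong n u v \<Longrightarrow> braid_cong n v u"
| trans: "braid_cong n u v \<Longrightarrow> braid_cong n v w \<Longrightarrow> braid_cong n u w"
| append: "braid_cong n u u' \<Longrightarrow> braid_cong n v v' \<Longrightarrow> braid_cong n (u @ v) (u' @ v')"
| cancel: "Suc i < n \<Longrightarrow> braid_cong n [(i, b), (i, \<not> b)] []"
| far: "Suc i < j \<Longrightarrow> Suc j < n \<Longrightarrow>
    braid_cong n [(i, True), (j, True)] [(j, True), (i, True)]"
| braid: "Suc (Suc i) < n \<Longrightarrow>
    braid_cong n [(i, True), (Suc i, True), (i, True)] [(Suc i, True), (i, True), (Suc i, True)]"

definition braid_rel :: "nat \<Rightarrow> (braid_word \<times> braid_word) set" where
  "braid_rel n = {(u, v). braid_cong n u v}"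

definition braid_group :: "nat \<Rightarrow> braid_word set monoid" where
  "braid_group n =
    \<lparr>carrier = braid_words n // braid_rel n,
     monoid.mult = (\<lambda>A B. \<Union>u\<in>A. \<Union>v\<in>B. braid_rel n `` {u @ v}),
     one = braid_rel n `` {[]}\<rparr>"

lemma braid_cong_words: "braid_cong n u v \<Longrightarrow> u \<in> braid_words n \<and> v \<in> braid_words n"
  by (induction rule: braid_cong.induct) (auto simp: braid_words_def)

lemma equiv_braid_rel: "equiv (braid_words n) (braid_rel n)"
proof (rule equivI)
  show "refl_on (braid_words n) (braid_rel n)"
    by (auto simp: refl_on_def braid_rel_def intro: braid_cong.refl)
  show "sym (braid_rel n)"
    by (auto simp: sym_def braid_rel_def intro: braid_cong.sym)
  show "trans (braid_rel n)"
    unfolding trans_def braid_rel_def by (auto intro: braid_cong.trans)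
  show "braid_rel n \<subseteq> braid_words n \<times> braid_words n"
    using braid_cong_words by (auto simp: braid_rel_def)
qed

lemma braid_group_mult_class:
  assumes "u \<in> braid_words n" "v \<in> braid_words n"
  shows "braid_rel n `` {u} \<otimes>\<^bsub>braid_group n\<^esub> braid_rel n `` {v} = braid_rel n `` {u @ v}"
proof -
  have "congruent2 (braid_rel n) (braid_rel n) (\<lambda>u v. braid_rel n `` {u @ v})"
  proof (rule congruent2I')
    fix u u' v v' assume "(u, u') \<in> braid_rel n" "(v, v') \<in> braid_rel n"
    then have "(u @ v, u' @ v') \<in> braid_rel n"
      by (auto simp: braid_rel_def intro: braid_cong.append)
    then show "braid_rel n `` {u @ v} = braid_rel n `` {u' @ v'}"
      by (rule equiv_class_eq[OF equiv_braid_rel])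
  qed
  then show ?thesis
    using UN_equiv_class2[OF equiv_braid_rel equiv_braid_rel _ assms]
    by (simp add: braid_group_def)
qed

lemma braid_group_carrierE:
  assumes "A \<in> carrier (braid_group n)"
  obtains w where "w \<in> braid_words n" "A = braid_rel n `` {w}"
  using assms by (auto simp: braid_group_def elim: quotientE)

lemma braid_class_carrier:
  "w \<in> braid_words n \<Longrightarrow> braid_rel n `` {w} \<in> carrier (braid_group n)"
  by (simp add: braid_group_def quotientI)

lemma braid_words_append:
  "u \<in> braid_words n \<Longrightarrow> v \<in> braid_words n \<Longrightarrow> u @ v \<in> braid_words n"
  by (auto simp: braid_words_def)

lemma braid_words_Nil: "[] \<in> braid_words n"
  by (simp add: braid_words_def)

lemma braid_word_left_inverse:
  "w \<in> braid_words n \<Longrightarrow> \<exists>w'\<in>braid_words n. braid_cong n (w' @ w) []"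
proof (induction w)
  case Nil
  then show ?case using braid_words_Nil braid_cong.refl by force
next
  case (Cons a w)
  obtain i b where a: "a = (i, b)" by (cases a)
  have w: "w \<in> braid_words n" and i: "Suc i < n"
    using Cons.prems a by (auto simp: braid_words_def)
  then obtain w' where w': "w' \<in> braid_words n" "braid_cong n (w' @ w) []"
    using Cons.IH by blast
  have "braid_cong n [(i, \<not> b), (i, b)] []"
    using braid_cong.cancel[OF i, of "\<not> b"] by simp
  from braid_cong.append[OF braid_cong.refl[OF w'(1)]
      braid_cong.append[OF this braid_cong.refl[OF w]]]
  have "braid_cong n ((w' @ [(i, \<not> b)]) @ a # w) (w' @ w)"
    by (simp add: a)
  then have "braid_cong n ((w' @ [(i, \<not> b)]) @ a # w) []"
    using w'(2) by (rule braid_cong.trans)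
  moreover have "w' @ [(i, \<not> b)] \<in> braid_words n"
    using w' i by (simp add: braid_words_def)
  ultimately show ?case by blast
qed

lemma group_braid_group: "group (braid_group n)"
proof (rule groupI)
  show one: "\<one>\<^bsub>braid_group n\<^esub> \<in> carrier (braid_group n)"
    using braid_class_carrier[OF braid_words_Nil] by (simp add: braid_group_def)
  fix A assume A: "A \<in> carrier (braid_group n)"
  then obtain u where u: "u \<in> braid_words n" "A = braid_rel n `` {u}"
    by (rule braid_group_carrierE)
  have one_eq: "\<one>\<^bsub>braid_group n\<^esub> = braid_rel n `` {[]}" by (simp add: braid_group_def)
  show "\<one>\<^bsub>braid_group n\<^esub> \<otimes>\<^bsub>braid_group n\<^esub> A = A"
    using braid_group_mult_class[OF braid_words_Nil u(1)] u(2) one_eq by simp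
  obtain u' where u': "u' \<in> braid_words n" "braid_cong n (u' @ u) []"
    using braid_word_left_inverse[OF u(1)] by blast
  then have "braid_rel n `` {u' @ u} = \<one>\<^bsub>braid_group n\<^esub>"
    unfolding one_eq by (intro equiv_class_eq[OF equiv_braid_rel]) (simp add: braid_rel_def)
  then show "\<exists>B\<in>carrier (braid_group n). B \<otimes>\<^bsub>braid_group n\<^esub> A = \<one>\<^bsub>braid_group n\<^esub>"
    using braid_group_mult_class[OF u'(1) u(1)] braid_class_carrier[OF u'(1)] u(2) by metis
  fix B assume "B \<in> carrier (braid_group n)"
  then obtain v where v: "v \<in> braid_words n" "B = braid_rel n `` {v}"
    by (rule braid_group_carrierE)
  show "A \<otimes>\<^bsub>braid_group n\<^esub> B \<in> carrier (braid_group n)"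
    using u v braid_class_carrier[OF braid_words_append[OF u(1) v(1)]]
    by (simp add: braid_group_mult_class)
  fix C assume "C \<in> carrier (braid_group n)"
  then obtain w where w: "w \<in> braid_words n" "C = braid_rel n `` {w}"
    by (rule braid_group_carrierE)
  show "A \<otimes>\<^bsub>braid_group n\<^esub> B \<otimes>\<^bsub>braid_group n\<^esub> C = A \<otimes>\<^bsub>braid_group n\<^esub> (B \<otimes>\<^bsub>braid_group n\<^esub> C)"
    using u v w by (simp add: braid_group_mult_class braid_words_append)
qed

section \<open>The Hurwitz action\<close>

fun hurwitz_letter :: "('a, 'c) monoid_scheme \<Rightarrow> 'a list \<Rightarrow> nat \<times> bool \<Rightarrow> 'a list" where
  "hurwitz_letter G F (i, True) =
    F[i := F ! Suc i, Suc i := inv\<^bsub>G\<^esub> (F ! Suc i) \<otimes>\<^bsub>G\<^esub> F ! i \<otimes>\<^bsub>G\<^esub> F ! Suc i]"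
| "hurwitz_letter G F (i, False) =
    F[i := F ! i \<otimes>\<^bsub>G\<^esub> F ! Suc i \<otimes>\<^bsub>G\<^esub> inv\<^bsub>G\<^esub> (F ! i), Suc i := F ! i]"

text \<open>A right action: the first letter of a word acts first.\<close>

definition hurwitz_word :: "('a, 'c) monoid_scheme \<Rightarrow> braid_word \<Rightarrow> 'a list \<Rightarrow> 'a list" where
  "hurwitz_word G w F = foldl (hurwitz_letter G) F w"

text \<open>
  The action of a braid (a class of words) on factorizations of length \<open>n\<close> over \<open>G\<close>. All
  words of the class act alike on such lists, see \<open>hurwitz_class\<close> below.
\<close>

definition hurwitz :: "('a, 'c) monoid_scheme \<Rightarrow> braid_word set \<Rightarrow> 'a list \<Rightarrow> 'a list" where
  "hurwitz G A F = the_elem ((\<lambda>w. hurwitz_word G w F) ` A)"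

text \<open>
  The library's \<^const>\<open>orbit\<close> and \<^const>\<open>stabilizer\<close> are defined for an arbitrary family of
  maps indexed by group elements, so they apply to this right action unchanged.
\<close>

definition hurwitz_equiv :: "('a, 'c) monoid_scheme \<Rightarrow> 'a list \<Rightarrow> 'a list \<Rightarrow> bool" where
  "hurwitz_equiv G F F' \<longleftrightarrow> F' \<in> orbit (braid_group (length F)) (hurwitz G) F"

lemma hurwitz_word_append: "hurwitz_word G (u @ v) F = hurwitz_word G v (hurwitz_word G u F)"
  by (simp add: hurwitz_word_def)

lemma length_hurwitz_letter: "length (hurwitz_letter G F a) = length F"
  by (cases "(G, F, a)" rule: hurwitz_letter.cases) simp_all

lemma length_hurwitz_word: "length (hurwitz_word G w F) = length F"
  unfolding hurwitz_word_def
  by (induction w arbitrary: F) (simp_all add: length_hurwitz_letter)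

context group
begin

lemma hurwitz_letter_closed:
  assumes "set F \<subseteq> carrier G" "Suc (fst a) < length F"
  shows "set (hurwitz_letter G F a) \<subseteq> carrier G"
proof -
  obtain i b where a: "a = (i, b)" by (cases a)
  have "F ! i \<in> carrier G" "F ! Suc i \<in> carrier G"
    using assms a by (auto intro!: subsetD[OF assms(1)] nth_mem)
  then show ?thesis
    using assms(1) a by (cases b) (simp_all add: set_update_subsetI)
qed

lemma inv_cancel:
  assumes "x \<in> carrier G" "y \<in> carrier G"
  shows "x \<otimes> (inv x \<otimes> y) = y" "inv x \<otimes> (x \<otimes> y) = y"
  using assms by (simp_all add: m_assoc[symmetric])

lemma hurwitz_word_closed:
  "w \<in> braid_words (length F) \<Longrightarrow> set F \<subseteq> carrier G \<Longrightarrow> set (hurwitz_word G w F) \<subseteq> carrier G"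
proof (induction w arbitrary: F)
  case Nil
  then show ?case by (simp add: hurwitz_word_def)
next
  case (Cons a w)
  then have a: "Suc (fst a) < length F" and w: "w \<in> braid_words (length F)"
    by (auto simp: braid_words_def)
  have "set (hurwitz_word G w (hurwitz_letter G F a)) \<subseteq> carrier G"
    using Cons.IH[of "hurwitz_letter G F a"] w hurwitz_letter_closed[OF Cons.prems(2) a]
    by (simp add: length_hurwitz_letter)
  then show ?case by (simp add: hurwitz_word_def)
qed

lemma hurwitz_word_cong:
  "braid_cong n u v \<Longrightarrow> length F = n \<Longrightarrow> set F \<subseteq> carrier G \<Longrightarrow>
    hurwitz_word G u F = hurwitz_word G v F"
proof (induction arbitrary: F rule: braid_cong.induct)
  case (append u u' v v')
  then show ?case
    using braid_cong_words[OF append.hyps(1)]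
    by (simp add: hurwitz_word_append length_hurwitz_word hurwitz_word_closed)
next
  case (cancel i b)
  let ?a = "F ! i" and ?b = "F ! Suc i"
  have ab: "?a \<in> carrier G" "?b \<in> carrier G"
    using cancel by (auto intro!: subsetD[OF cancel.prems(2)] nth_mem)
  have eq: "?b \<otimes> (inv ?b \<otimes> ?a \<otimes> ?b) \<otimes> inv ?b = ?a"
    "inv ?a \<otimes> (?a \<otimes> ?b \<otimes> inv ?a) \<otimes> ?a = ?b"
    using ab by (simp_all add: m_assoc inv_cancel)
  have len: "i < length F" "Suc i < length F"
    using cancel by simp_all
  show ?case
  proof (cases b)
    case True
    then show ?thesis
      using len eq(1) by (simp add: hurwitz_word_def list_update_swap[of "Suc i" i])
  next
    case False
    then show ?thesis
      using len eq(2) by (simp add: hurwitz_word_def list_update_swap[of "Suc i" i])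
  qed
next
  case (far i j)
  then have d: "i \<noteq> j" "i \<noteq> Suc j" "Suc i \<noteq> j" "Suc i \<noteq> Suc j" "j < length F"
    by simp_all
  then show ?case
    by (simp add: hurwitz_word_def list_update_swap[of j i] list_update_swap[of "Suc j" i]
        list_update_swap[of j "Suc i"] list_update_swap[of "Suc j" "Suc i"])
next
  case (braid i)
  let ?a = "F ! i" and ?b = "F ! Suc i" and ?c = "F ! Suc (Suc i)"
  let ?bc = "inv ?c \<otimes> ?b \<otimes> ?c"
  have abc: "?a \<in> carrier G" "?b \<in> carrier G" "?c \<in> carrier G"
    using braid by (auto intro!: subsetD[OF braid.prems(2)] nth_mem)
  have eq: "inv ?bc \<otimes> (inv ?c \<otimes> ?a \<otimes> ?c) \<otimes> ?bc = inv ?c \<otimes> (inv ?b \<otimes> ?a \<otimes> ?b) \<otimes> ?c"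
    using abc by (simp add: m_assoc inv_cancel inv_mult_group)
  have len: "i < length F" "Suc i < length F" "Suc (Suc i) < length F"
    using braid by simp_all
  show ?case
    using len eq by (simp add: hurwitz_word_def list_update_swap[of "Suc i" i]
        list_update_swap[of "Suc (Suc i)" "Suc i"] list_update_swap[of "Suc (Suc i)" i])
qed auto

lemma hurwitz_class:
  assumes "w \<in> braid_words (length F)" "set F \<subseteq> carrier G"
  shows "hurwitz G (braid_rel (length F) `` {w}) F = hurwitz_word G w F"
proof -
  have "hurwitz_word G v F = hurwitz_word G w F" if "v \<in> braid_rel (length F) `` {w}" for v
    using that hurwitz_word_cong[of "length F" w v F] assms(2) by (simp add: braid_rel_def)
  moreover have "w \<in> braid_rel (length F) `` {w}"
    using equiv_class_self[OF equiv_braid_rel assms(1)] .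
  ultimately have "(\<lambda>v. hurwitz_word G v F) ` (braid_rel (length F) `` {w}) = {hurwitz_word G w F}"
    by blast
  then show ?thesis by (simp add: hurwitz_def)
qed

end

section \<open>Conjugation and normal closures\<close>

definition conj_by :: "('a, 'c) monoid_scheme \<Rightarrow> 'a \<Rightarrow> 'a \<Rightarrow> 'a" where
  "conj_by G a b = inv\<^bsub>G\<^esub> b \<otimes>\<^bsub>G\<^esub> a \<otimes>\<^bsub>G\<^esub> b"

definition normal_closure :: "('a, 'c) monoid_scheme \<Rightarrow> 'a set \<Rightarrow> 'a set" where
  "normal_closure G S = \<Inter> {H. H \<lhd> G \<and> S \<subseteq> H}"

end

theory Submission
  imports Defs
begin

text \<open>
  Call an entry of a factorization in $G_1 \oplus G_2$ central if its second component is $1$. A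
  Hurwitz move at two central entries, or at a central and a non-central one, conjugates at most one of
  them, and it conjugates a non-central entry only by a central one, whose first component lies
  in $N$. A move at two non-central entries is a Hurwitz move on the subsequence of non-central
  entries. So the $K$-classes of the first components of the central entries are preserved as a
  multiset, and a braid on $n + m$ strands induces one on $m$ strands, which describes the
  non-central subsequence exactly in $G_2$ and up to conjugation by $N$ in $G_1$. If the $z_i$
  are restored, the induced braid stabilizes them, hence it stabilizes the $y_i$.
\<close>

section \<open>Conjugation, single Hurwitz moves and normal closures\<close>

lemma split_at_adjacent:
  assumes "Suc i < length F"
  obtains A p q B where "F = A @ p # q # B" "length A = i"
proof
  show "F = take i F @ F ! i # F ! Suc i # drop (Suc (Suc i)) F"
    using assms by (simp add: Cons_nth_drop_Suc Suc_lessD)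
  show "length (take i F) = i" using assms by simp
qed

context group
begin

lemma conj_by_closed [simp]:
  "a \<in> carrier G \<Longrightarrow> b \<in> carrier G \<Longrightarrow> conj_by G a b \<in> carrier G"
  by (simp add: conj_by_def)

lemma conj_by_mult:
  "\<lbrakk>a \<in> carrier G; b \<in> carrier G; c \<in> carrier G\<rbrakk> \<Longrightarrow>
    conj_by G (conj_by G a b) c = conj_by G a (b \<otimes> c)"
  by (simp add: conj_by_def m_assoc inv_mult_group)

lemma conj_by_one [simp]: "a \<in> carrier G \<Longrightarrow> conj_by G a \<one> = a"
  by (simp add: conj_by_def)

lemma conj_by_conj_inv [simp]:
  "a \<in> carrier G \<Longrightarrow> b \<in> carrier G \<Longrightarrow> conj_by G (conj_by G a b) (inv b) = a"
  by (simp add: conj_by_mult)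

lemma inv_conj_by:
  "a \<in> carrier G \<Longrightarrow> b \<in> carrier G \<Longrightarrow> inv (conj_by G a b) = conj_by G (inv a) b"
  by (simp add: conj_by_def m_assoc inv_mult_group)

text \<open>Applied to second components, this shows that an entry conjugated by a move stays
  central or stays non-central.\<close>

lemma conj_by_eq_one_iff [simp]:
  assumes "a \<in> carrier G" "b \<in> carrier G"
  shows "conj_by G a b = \<one> \<longleftrightarrow> a = \<one>"
proof
  assume "conj_by G a b = \<one>"
  then have "conj_by G \<one> (inv b) = a" using assms by (metis conj_by_conj_inv)
  then show "a = \<one>" using assms by (simp add: conj_by_def)
qed (use assms in \<open>simp add: conj_by_def\<close>)

lemma hurwitz_letter_True:
  "hurwitz_letter G (A @ p # q # B) (length A, True) = A @ q # conj_by G p q # B"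
  by (simp add: conj_by_def nth_append list_update_append)

text \<open>Writing the inverse move as conjugation by \<open>inv p\<close> lets both kinds of
  letter share the lemmas on \<open>conj_by\<close>. Closedness of \<open>p\<close> gives
  \<open>inv (inv p) = p\<close>.\<close>

lemma hurwitz_letter_False:
  "p \<in> carrier G \<Longrightarrow>
    hurwitz_letter G (A @ p # q # B) (length A, False) = A @ conj_by G q (inv p) # p # B"
  by (simp add: conj_by_def nth_append list_update_append)

lemma normal_normal_closure:
  assumes "S \<subseteq> carrier G"
  shows "normal_closure G S \<lhd> G"
proof (rule normal_invI)
  \<comment> \<open>An intersection of subgroups needs a non-empty family; the whole group is always
    a member.\<close>
  have ne: "carrier G \<in> {H. H \<lhd> G \<and> S \<subseteq> H}"
    using assms by (auto intro: normal_invI subgroup_self)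
  show "subgroup (normal_closure G S) G"
    unfolding normal_closure_def
    by (rule subgroups_Inter) (use ne in \<open>auto intro: normal_imp_subgroup\<close>)
  show "x \<otimes> h \<otimes> inv x \<in> normal_closure G S"
    if "x \<in> carrier G" "h \<in> normal_closure G S" for x h
    using that by (auto simp: normal_closure_def intro: normal.inv_op_closed2)
qed

end

lemma subset_normal_closure: "S \<subseteq> normal_closure G S"
  by (auto simp: normal_closure_def)

section \<open>Conjugation by a subgroup K and by a normal subgroup N of K\<close>

locale normal_in_subgroup = group G for G (structure) +
  fixes K N
  assumes K: "subgroup K G" and NK: "N \<lhd> G\<lparr>carrier := K\<rparr>"
begin

lemma K_carrier: "a \<in> K \<Longrightarrow> a \<in> carrier G"
  using K by (rule subgroup.mem_carrier)

lemma conj_by_K: "a \<in> K \<Longrightarrow> b \<in> K \<Longrightarrow> conj_by G a b \<in> K"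
  unfolding conj_by_def using K by (simp add: subgroup.m_closed subgroup.m_inv_closed)

lemma inv_K: "a \<in> K \<Longrightarrow> inv a \<in> K"
  using K by (rule subgroup.m_inv_closed)

lemma subgroup_N: "subgroup N G"
  using incl_subgroup[OF K] normal_imp_subgroup[OF NK] by blast

lemma N_K: "h \<in> N \<Longrightarrow> h \<in> K"
  using subgroup.subset[OF normal_imp_subgroup[OF NK]] by auto

lemma conj_by_N:
  assumes "h \<in> N" "k \<in> K"
  shows "conj_by G h k \<in> N"
  \<comment> \<open>Normality of \<open>N\<close> speaks of the inverse in the structure restricted
    to \<open>K\<close>; it agrees with the inverse in \<open>G\<close>.\<close>
  using normal.inv_op_closed1[OF NK, of k h] assms m_inv_consistent[OF K assms(2)]
  by (simp add: conj_by_def)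

text \<open>Having classes as sets turns "conjugate in \<open>K\<close> up to reordering" into an
  equality of multisets, from which the permutation is extracted at the end.\<close>

definition conj_class :: "'a \<Rightarrow> 'a set" where
  "conj_class a = conj_by G a ` K"

lemma conj_class_self: "a \<in> K \<Longrightarrow> a \<in> conj_class a"
  unfolding conj_class_def using subgroup.one_closed[OF K] K_carrier
  by (intro image_eqI[of _ _ \<one>]) simp_all

lemma conj_class_conj_by_subset:
  "a \<in> K \<Longrightarrow> k \<in> K \<Longrightarrow> conj_class (conj_by G a k) \<subseteq> conj_class a"
  unfolding conj_class_def
  by (auto simp: conj_by_mult K_carrier intro!: imageI subgroup.m_closed[OF K])

text \<open>The inclusion is applied twice, the second time to conjugation back by
  \<open>inv k\<close>.\<close>

lemma conj_class_conj_by: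
  assumes "a \<in> K" "k \<in> K"
  shows "conj_class (conj_by G a k) = conj_class a"
  using conj_class_conj_by_subset[OF assms]
    conj_class_conj_by_subset[OF conj_by_K[OF assms] inv_K[OF assms(2)]] assms
  by (simp add: K_carrier)

text \<open>Membership in \<open>K\<close> is built in so that \<open>list_all2 N_conj\<close> also
  carries the closure conditions needed entry by entry.\<close>

definition N_conj :: "'a \<Rightarrow> 'a \<Rightarrow> bool" where
  "N_conj a b \<longleftrightarrow> a \<in> K \<and> b \<in> K \<and> (\<exists>h\<in>N. b = conj_by G a h)"

lemma N_conj_conj_by: "a \<in> K \<Longrightarrow> h \<in> N \<Longrightarrow> N_conj a (conj_by G a h)"
  by (auto simp: N_conj_def conj_by_K N_K)

lemma N_conj_refl: "a \<in> K \<Longrightarrow> N_conj a a"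
  using N_conj_conj_by[OF _ subgroup.one_closed[OF subgroup_N]] by (simp add: K_carrier)

lemma N_conj_trans: "N_conj a b \<Longrightarrow> N_conj b c \<Longrightarrow> N_conj a c"
  unfolding N_conj_def
  by (auto simp: conj_by_mult K_carrier N_K intro!: bexI subgroup.m_closed[OF subgroup_N])

lemma N_conj_inv: "N_conj a b \<Longrightarrow> N_conj (inv a) (inv b)"
  by (auto simp: N_conj_def inv_conj_by K_carrier N_K inv_K)

text \<open>Conjugating by $b^k$ instead of $b$ is harmless because $N$ is normal in $K$.\<close>

lemma N_conj_conj_by_conj_by:
  assumes "N_conj a a'" "N_conj b b'"
  shows "N_conj (conj_by G a b) (conj_by G a' b')"
proof -
  obtain h k where h: "h \<in> N" "a' = conj_by G a h" and k: "k \<in> N" "b' = conj_by G b k"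
    and a: "a \<in> K" and b: "b \<in> K"
    using assms by (auto simp: N_conj_def)
  \<comment> \<open>The conjugator comes from \<open>h \<otimes> inv k \<otimes> b \<otimes> k = b
    \<otimes> conj_by G (h \<otimes> inv k) b \<otimes> k\<close>: moving \<open>b\<close> to the
    front conjugates an element of \<open>N\<close> by it.\<close>
  have "conj_by G a' b' = conj_by G (conj_by G a b) (conj_by G (h \<otimes> inv k) b \<otimes> k)"
    using h k a b
    by (simp add: conj_by_def K_carrier N_K m_assoc inv_mult_group inv_cancel)
  moreover have "conj_by G (h \<otimes> inv k) b \<otimes> k \<in> N"
    using h k b
    by (simp add: conj_by_N subgroup.m_closed[OF subgroup_N] subgroup.m_inv_closed[OF subgroup_N])
  ultimately show ?thesis
    using N_conj_conj_by conj_by_K[OF a b] by simp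
qed

text \<open>Each of the two new entries is an old one or an old one conjugated by its neighbour or
  the inverse of it, and all of these operations respect \<open>N_conj\<close>.\<close>

lemma N_conj_hurwitz_letter:
  assumes "list_all2 N_conj F F'" "Suc i < length F"
  shows "list_all2 N_conj (hurwitz_letter G F (i, b)) (hurwitz_letter G F' (i, b))"
proof -
  obtain A p q B where F: "F = A @ p # q # B" "length A = i"
    using assms(2) by (rule split_at_adjacent)
  then obtain A' p' q' B' where F': "F' = A' @ p' # q' # B'" "length A' = i"
    and AB: "list_all2 N_conj A A'" "list_all2 N_conj B B'"
    and pq: "N_conj p p'" "N_conj q q'"
    using assms(1) by (auto simp: list_all2_append1 list_all2_Cons1)
  have c: "p \<in> carrier G" "p' \<in> carrier G"
    using pq by (auto simp: N_conj_def K_carrier)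
  show ?thesis
    using hurwitz_letter_True[of A p q B] hurwitz_letter_True[of A' p' q' B']
      hurwitz_letter_False[of p A q B] hurwitz_letter_False[of p' A' q' B'] AB pq c
      N_conj_conj_by_conj_by N_conj_inv
    unfolding F(1) F'(1) F(2) F'(2)
    by (cases b) (simp_all add: list_all2_appendI)
qed

text \<open>This is what allows induced braids to be composed: the second one acts on a list known
  only up to conjugation by \<open>N\<close>.\<close>

lemma N_conj_hurwitz_word:
  "list_all2 N_conj F F' \<Longrightarrow> w \<in> braid_words (length F) \<Longrightarrow>
    list_all2 N_conj (hurwitz_word G w F) (hurwitz_word G w F')"
proof (induction w arbitrary: F F')
  case (Cons a w)
  obtain i b where a: "a = (i, b)" by (cases a)
  then show ?case
    using Cons N_conj_hurwitz_letter[of F F' i b]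
    by (simp add: hurwitz_word_def braid_words_def length_hurwitz_letter)
qed (simp add: hurwitz_word_def)

end

section \<open>Central and non-central entries of factorizations in the product\<close>

locale hurwitz_product = normal_in_subgroup G1 K N + G2: group G2
  for G1 :: "('a, 'c) monoid_scheme" (structure) and K N and G2 :: "('b, 'd) monoid_scheme"
begin

definition central_part :: "('a \<times> 'b) list \<Rightarrow> 'a list" where
  "central_part F = map fst (filter (\<lambda>p. snd p = \<one>\<^bsub>G2\<^esub>) F)"

definition rest :: "('a \<times> 'b) list \<Rightarrow> ('a \<times> 'b) list" where
  "rest F = filter (\<lambda>p. snd p \<noteq> \<one>\<^bsub>G2\<^esub>) F"

text \<open>The invariant kept by every Hurwitz move. Central entries have to lie in
  \<open>N\<close> because non-central entries are conjugated by them in passing.\<close>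

definition admissible :: "('a \<times> 'b) list \<Rightarrow> bool" where
  "admissible F \<longleftrightarrow> set F \<subseteq> K \<times> carrier G2 \<and> set (central_part F) \<subseteq> N"

text \<open>A single word \<open>u\<close> serves both projections; this is what later carries a
  stabilizer condition from \<open>G2\<close> to \<open>G1\<close>.\<close>

definition tracked :: "('a \<times> 'b) list \<Rightarrow> ('a \<times> 'b) list \<Rightarrow> bool" where
  "tracked F F' \<longleftrightarrow> mset (map conj_class (central_part F')) = mset (map conj_class (central_part F)) \<and>
    (\<exists>u\<in>braid_words (length (rest F)).
      map snd (rest F') = hurwitz_word G2 u (map snd (rest F)) \<and>
      list_all2 N_conj (hurwitz_word G1 u (map fst (rest F))) (map fst (rest F')))"

lemma conj_by_DirProd:
  assumes "a \<in> carrier G1" "b \<in> carrier G1" "s \<in> carrier G2" "t \<in> carrier G2"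
  shows "conj_by (G1 \<times>\<times> G2) (a, s) (b, t) = (conj_by G1 a b, conj_by G2 s t)"
    and "conj_by (G1 \<times>\<times> G2) (a, s) (inv\<^bsub>G1 \<times>\<times> G2\<^esub> (b, t)) =
      (conj_by G1 a (inv b), conj_by G2 s (inv\<^bsub>G2\<^esub> t))"
  using assms inv_DirProd[OF is_group G2.is_group] by (simp_all add: conj_by_def)

lemma central_part_simps:
  "central_part [] = []"
  "central_part (p # F) = (if snd p = \<one>\<^bsub>G2\<^esub> then fst p # central_part F else central_part F)"
  "central_part (F @ F') = central_part F @ central_part F'"
  by (simp_all add: central_part_def)

lemma rest_simps:
  "rest [] = []"
  "rest (p # F) = (if snd p \<noteq> \<one>\<^bsub>G2\<^esub> then p # rest F else rest F)"
  "rest (F @ F') = rest F @ rest F'"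
  by (simp_all add: rest_def)

lemma N_conj_refl_rest:
  "set F \<subseteq> K \<times> carrier G2 \<Longrightarrow> list_all2 N_conj (map fst (rest F)) (map fst (rest F))"
  by (intro list_all2_same[THEN iffD2]) (auto simp: rest_def intro: N_conj_refl)

text \<open>Covers moves that involve a central entry: the induced braid is trivial.\<close>

lemma tracked_Nil:
  assumes "mset (map conj_class (central_part F')) = mset (map conj_class (central_part F))"
    "map snd (rest F') = map snd (rest F)"
    "list_all2 N_conj (map fst (rest F)) (map fst (rest F'))"
  shows "tracked F F'"
  unfolding tracked_def
  by (intro conjI assms(1) bexI[of _ "[]"])
    (use assms in \<open>simp_all add: hurwitz_word_def braid_words_Nil\<close>)

text \<open>Covers moves at two non-central entries: the induced braid is one letter, whose index
  \<open>i\<close> counts positions in \<open>rest F\<close> and not in \<open>F\<close>.\<close>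

lemma tracked_letter:
  assumes "mset (map conj_class (central_part F')) = mset (map conj_class (central_part F))"
    "Suc i < length (rest F)"
    "map snd (rest F') = hurwitz_letter G2 (map snd (rest F)) (i, b)"
    "map fst (rest F') = hurwitz_letter G1 (map fst (rest F)) (i, b)"
    "set F' \<subseteq> K \<times> carrier G2"
  shows "tracked F F'"
  unfolding tracked_def
  by (intro conjI assms(1) bexI[of _ "[(i, b)]"])
    (use assms N_conj_refl_rest[OF assms(5)] in \<open>simp_all add: hurwitz_word_def braid_words_def\<close>)

lemma tracked_refl: "admissible F \<Longrightarrow> tracked F F"
  using N_conj_refl_rest by (intro tracked_Nil) (auto simp: admissible_def)

lemma tracked_trans:
  assumes "tracked F F'" "tracked F' F''"
  shows "tracked F F''"
proof -
  obtain u where u: "u \<in> braid_words (length (rest F))"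
      "map snd (rest F') = hurwitz_word G2 u (map snd (rest F))"
      "list_all2 N_conj (hurwitz_word G1 u (map fst (rest F))) (map fst (rest F'))"
    using assms(1) by (auto simp: tracked_def)
  obtain v where v: "v \<in> braid_words (length (rest F'))"
      "map snd (rest F'') = hurwitz_word G2 v (map snd (rest F'))"
      "list_all2 N_conj (hurwitz_word G1 v (map fst (rest F'))) (map fst (rest F''))"
    using assms(2) by (auto simp: tracked_def)
  have len: "length (rest F') = length (rest F)"
    using arg_cong[OF u(2), of length] by (simp add: length_hurwitz_word)
  \<comment> \<open>Over \<open>G1\<close> the word \<open>u\<close> reaches \<open>rest F'\<close>
    only up to \<open>N\<close>, so \<open>v\<close> is applied to both lists before chaining with
    its own relation.\<close>
  have "list_all2 N_conj (hurwitz_word G1 v (hurwitz_word G1 u (map fst (rest F))))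
      (hurwitz_word G1 v (map fst (rest F')))"
    using N_conj_hurwitz_word[OF u(3)] v(1) len by (simp add: length_hurwitz_word)
  from list_all2_trans[OF N_conj_trans this v(3)]
  have "list_all2 N_conj (hurwitz_word G1 (u @ v) (map fst (rest F))) (map fst (rest F''))"
    by (simp add: hurwitz_word_append)
  moreover have "u @ v \<in> braid_words (length (rest F))"
    using u(1) v(1) len by (simp add: braid_words_append)
  moreover have "map snd (rest F'') = hurwitz_word G2 (u @ v) (map snd (rest F))"
    using u(2) v(2) by (simp add: hurwitz_word_append)
  ultimately show ?thesis
    using assms unfolding tracked_def by metis
qed

lemma tracked_hurwitz_letter:
  assumes adm: "admissible F" and i: "Suc i < length F"
  shows "admissible (hurwitz_letter (G1 \<times>\<times> G2) F (i, b)) \<and>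
    tracked F (hurwitz_letter (G1 \<times>\<times> G2) F (i, b))"
proof -
  interpret P: group "G1 \<times>\<times> G2" by (rule DirProd_group[OF is_group G2.is_group])
  obtain A p q B where "F = A @ p # q # B" and lA: "length A = i"
    using i by (rule split_at_adjacent)
  then obtain x s y t where F: "F = A @ (x, s) # (y, t) # B" by (cases p, cases q) auto
  have K': "x \<in> K" "y \<in> K" and st: "s \<in> carrier G2" "t \<in> carrier G2"
    and AB: "set A \<subseteq> K \<times> carrier G2" "set B \<subseteq> K \<times> carrier G2"
    using adm by (auto simp: admissible_def F)
  have cAB: "set (central_part A) \<subseteq> N" "set (central_part B) \<subseteq> N"
    and xN: "s = \<one>\<^bsub>G2\<^esub> \<Longrightarrow> x \<in> N" and yN: "t = \<one>\<^bsub>G2\<^esub> \<Longrightarrow> y \<in> N"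
    using adm by (auto simp: admissible_def F central_part_simps split: if_splits)
  note K1 = K'[THEN K_carrier] and iK = K'[THEN inv_K]
  note rfl = N_conj_refl_rest[OF AB(1)] N_conj_refl_rest[OF AB(2)] K'[THEN N_conj_refl]
  define F' where "F' = hurwitz_letter (G1 \<times>\<times> G2) F (i, b)"
  have F': "F' = (if b then A @ (y, t) # (conj_by G1 x y, conj_by G2 s t) # B
      else A @ (conj_by G1 y (inv x), conj_by G2 t (inv\<^bsub>G2\<^esub> s)) # (x, s) # B)"
    using P.hurwitz_letter_True[of A "(x, s)" "(y, t)" B]
      P.hurwitz_letter_False[of "(x, s)" A "(y, t)" B] K1 st
    by (cases b) (simp_all add: F'_def F lA conj_by_DirProd)
  have adm': "admissible F'"
    using K' iK st AB cAB xN yN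
    by (auto simp: admissible_def F' central_part_simps conj_by_K conj_by_N)
  \<comment> \<open>Central entries are only reordered or replaced by \<open>K\<close>-conjugates,
    whichever of the two entries are central.\<close>
  have cent: "mset (map conj_class (central_part F')) = mset (map conj_class (central_part F))"
    using K' iK st by (simp add: F F' central_part_simps conj_class_conj_by)
  have "tracked F F'"
  proof (cases "s = \<one>\<^bsub>G2\<^esub> \<or> t = \<one>\<^bsub>G2\<^esub>")
    case True
    \<comment> \<open>If a non-central entry is conjugated here, the other entry is central, so the
      conjugator in \<open>G1\<close> is an element of \<open>N\<close> or its inverse, and the one
      in \<open>G2\<close> is trivial.\<close>
    have "list_all2 N_conj (map fst (rest F)) (map fst (rest F'))"
      using True K' iK K1 st xN yN rfl
      by (auto simp: F F' rest_simps subgroup.m_inv_closed[OF subgroup_N]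
          intro!: list_all2_appendI N_conj_conj_by)
    moreover have "map snd (rest F') = map snd (rest F)"
      using True st by (auto simp: F F' rest_simps conj_by_def)
    ultimately show ?thesis using tracked_Nil[OF cent] by blast
  next
    case False
    let ?A = "map fst (rest A)" and ?B = "map fst (rest B)"
    let ?A2 = "map snd (rest A)" and ?B2 = "map snd (rest B)"
    show ?thesis
    proof (rule tracked_letter[OF cent])
      \<comment> \<open>Both entries survive in \<open>rest F\<close> and stay adjacent; dropping
        the central entries of \<open>A\<close> shifts their position from \<open>length A\<close>
        to \<open>length (rest A)\<close>.\<close>
      show "Suc (length (rest A)) < length (rest F)"
        using False by (simp add: F rest_simps)
      show "map snd (rest F') = hurwitz_letter G2 (map snd (rest F)) (length (rest A), b)"
        using False st G2.hurwitz_letter_True[of ?A2 s t ?B2] G2.hurwitz_letter_False[of s ?A2 t ?B2]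
        by (cases b) (simp_all add: F F' rest_simps)
      show "map fst (rest F') = hurwitz_letter G1 (map fst (rest F)) (length (rest A), b)"
        using False st K1 hurwitz_letter_True[of ?A x y ?B] hurwitz_letter_False[of x ?A y ?B]
        by (cases b) (simp_all add: F F' rest_simps)
      show "set F' \<subseteq> K \<times> carrier G2" using adm' by (simp add: admissible_def)
    qed
  qed
  with adm' show ?thesis by (simp add: F'_def)
qed

lemma tracked_hurwitz_word:
  "admissible F \<Longrightarrow> w \<in> braid_words (length F) \<Longrightarrow>
    admissible (hurwitz_word (G1 \<times>\<times> G2) w F) \<and> tracked F (hurwitz_word (G1 \<times>\<times> G2) w F)"
proof (induction w arbitrary: F)
  case Nil
  then show ?case using tracked_refl by (simp add: hurwitz_word_def)
next
  case (Cons a w)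
  obtain i b where a: "a = (i, b)" by (cases a)
  have i: "Suc i < length F" and w: "w \<in> braid_words (length F)"
    using Cons.prems(2) by (auto simp: a braid_words_def)
  note step = tracked_hurwitz_letter[OF Cons.prems(1) i, of b]
  show ?case
    using Cons.IH[of "hurwitz_letter (G1 \<times>\<times> G2) F a"] step tracked_trans w
    by (auto simp: a hurwitz_word_def length_hurwitz_letter)
qed

lemma central_part_map_zip:
  assumes "length ys = length zs" "\<forall>i<length zs. zs ! i \<noteq> \<one>\<^bsub>G2\<^esub>"
  shows "central_part (map (\<lambda>x. (x, \<one>\<^bsub>G2\<^esub>)) xs @ zip ys zs) = xs"
    and "rest (map (\<lambda>x. (x, \<one>\<^bsub>G2\<^esub>)) xs @ zip ys zs) = zip ys zs"
proof -
  have "snd p \<noteq> \<one>\<^bsub>G2\<^esub>" if "p \<in> set (zip ys zs)" for p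
    using that assms by (auto simp: set_zip)
  then have "filter (\<lambda>p. snd p = \<one>\<^bsub>G2\<^esub>) (zip ys zs) = []"
    "filter (\<lambda>p. snd p \<noteq> \<one>\<^bsub>G2\<^esub>) (zip ys zs) = zip ys zs"
    by (simp_all add: filter_empty_conv filter_id_conv)
  then show "central_part (map (\<lambda>x. (x, \<one>\<^bsub>G2\<^esub>)) xs @ zip ys zs) = xs"
    "rest (map (\<lambda>x. (x, \<one>\<^bsub>G2\<^esub>)) xs @ zip ys zs) = zip ys zs"
    by (simp_all add: central_part_def rest_def filter_map comp_def)
qed

end

theorem theorem3p2:
  fixes G1 :: "('a, 'c) monoid_scheme" and G2 :: "('b, 'd) monoid_scheme"
    and xs xs' ys ys' :: "'a list" and zs :: "'b list" and n m :: nat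
    and F1 F2 :: "('a \<times> 'b) list" and K N :: "'a set"
  assumes "group G1" and "group G2"
    and "length xs = n" and "length xs' = n"
    and "length ys = m" and "length ys' = m" and "length zs = m"
    and "set xs \<subseteq> carrier G1" and "set xs' \<subseteq> carrier G1"
    and "set ys \<subseteq> carrier G1" and "set ys' \<subseteq> carrier G1"
    and "set zs \<subseteq> carrier G2"
    and "F1 = map (\<lambda>x. (x, \<one>\<^bsub>G2\<^esub>)) xs @ zip ys zs"
    and "F2 = map (\<lambda>x. (x, \<one>\<^bsub>G2\<^esub>)) xs' @ zip ys' zs"
    and "K = generate G1 (set xs \<union> set ys)"
    and "N = normal_closure (G1\<lparr>carrier := K\<rparr>) (set xs)"
    and "hurwitz_equiv (G1 \<times>\<times> G2) F1 F2"
    and "\<forall>i<m. zs ! i \<noteq> \<one>\<^bsub>G2\<^esub>"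
  shows "(\<exists>\<pi>. \<pi> permutes {..<n} \<and>
           (\<forall>i<n. (\<exists>k\<in>K. xs' ! i = conj_by G1 (xs ! \<pi> i) k) \<and> xs' ! i \<in> N)) \<and>
         (stabilizer (braid_group m) (hurwitz G2) zs
            \<subseteq> stabilizer (braid_group m) (hurwitz G1) ys \<longrightarrow>
          (\<forall>i<m. \<exists>h\<in>N. ys' ! i = conj_by G1 (ys ! i) h))"
proof -
  let ?P = "G1 \<times>\<times> G2"
  interpret G1: group G1 by fact
  interpret G2: group G2 by fact
  interpret P: group ?P by (rule DirProd_group) unfold_locales
  have gens: "set xs \<union> set ys \<subseteq> carrier G1" using assms by simp
  have K: "subgroup K G1" using G1.generate_is_subgroup[OF gens] assms by simp
  have xyK: "set xs \<subseteq> K" "set ys \<subseteq> K"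
    using generate.incl[of _ "set xs \<union> set ys" G1] assms by auto
  interpret KG: group "G1\<lparr>carrier := K\<rparr>" by (rule G1.subgroup_imp_group[OF K])
  have N: "N \<lhd> G1\<lparr>carrier := K\<rparr>"
    using KG.normal_normal_closure[of "set xs"] xyK assms by simp
  interpret hurwitz_product G1 K N G2
    by (intro hurwitz_product.intro normal_in_subgroup.intro normal_in_subgroup_axioms.intro
        K N G1.is_group G2.is_group)
  have xN: "set xs \<subseteq> N" using subset_normal_closure assms by metis
  have nz: "\<forall>i<length zs. zs ! i \<noteq> \<one>\<^bsub>G2\<^esub>" using assms by simp
  have F1: "central_part F1 = xs" "rest F1 = zip ys zs"
    and F2: "central_part F2 = xs'" "rest F2 = zip ys' zs"
    using central_part_map_zip nz assms by simp_all
  have F1K: "set F1 \<subseteq> K \<times> carrier G2"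
    using xyK \<open>set zs \<subseteq> carrier G2\<close> assms(13)
    by (auto dest: set_zip_leftD set_zip_rightD)
  then have adm: "admissible F1" using xN by (simp add: admissible_def F1)
  have carr: "set F1 \<subseteq> carrier ?P" using F1K K_carrier by auto
  obtain C where "C \<in> carrier (braid_group (length F1))" "F2 = hurwitz ?P C F1"
    using assms(17) by (auto simp: hurwitz_equiv_def orbit_def)
  \<comment> \<open>All words of a class act alike, so the braid is replaced by a
    representative.\<close>
  then obtain w where w: "w \<in> braid_words (length F1)" "F2 = hurwitz_word ?P w F1"
    using P.hurwitz_class[OF _ carr] by (metis braid_group_carrierE)
  have adm2: "admissible F2" and tr: "tracked F1 F2"
    using tracked_hurwitz_word[OF adm w(1)] w(2) by simp_all
  have xs'N: "set xs' \<subseteq> N" using adm2 by (simp add: admissible_def F2)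
  have "mset (map conj_class xs') = mset (map conj_class xs)"
    using tr by (simp add: tracked_def F1 F2)
  then obtain \<pi> where \<pi>: "\<pi> permutes {..<n}"
    and perm: "permute_list \<pi> (map conj_class xs) = map conj_class xs'"
    using assms(3) by (metis mset_eq_permutation length_map)
  have part1: "(\<exists>k\<in>K. xs' ! i = conj_by G1 (xs ! \<pi> i) k) \<and> xs' ! i \<in> N" if i: "i < n" for i
  proof -
    have "\<pi> i < n" using permutes_in_image[OF \<pi>] i by simp
    then have "conj_class (xs' ! i) = conj_class (xs ! \<pi> i)"
      using arg_cong[OF perm, of "\<lambda>l. l ! i"] i \<pi> assms(3,4) by (simp add: permute_list_nth)
    moreover have "xs' ! i \<in> N" using xs'N i assms(4) by auto
    \<comment> \<open>The entry \<open>xs' ! i\<close> lies in its own class, hence in that of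
      \<open>xs ! \<pi> i\<close>, which yields the conjugator in \<open>K\<close>.\<close>
    ultimately show ?thesis
      using conj_class_self[OF N_K] unfolding conj_class_def by blast
  qed
  have part2: "\<exists>h\<in>N. ys' ! i = conj_by G1 (ys ! i) h"
    if stab: "stabilizer (braid_group m) (hurwitz G2) zs \<subseteq> stabilizer (braid_group m) (hurwitz G1) ys"
      and i: "i < m" for i
  proof -
    \<comment> \<open>Both factorizations have \<open>zs\<close> as second components of their
      non-central entries, so the induced word fixes \<open>zs\<close>.\<close>
    obtain u where u: "u \<in> braid_words m" "zs = hurwitz_word G2 u zs"
      "list_all2 N_conj (hurwitz_word G1 u ys) ys'"
      using tr assms(5-7) by (auto simp: tracked_def F1 F2)
    have "braid_rel m `` {u} \<in> stabilizer (braid_group m) (hurwitz G2) zs"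
      using u G2.hurwitz_class[of u zs] assms(7,12) braid_class_carrier[OF u(1)]
      by (simp add: stabilizer_def)
    then have "hurwitz G1 (braid_rel m `` {u}) ys = ys"
      using stab by (auto simp: stabilizer_def)
    then have "hurwitz_word G1 u ys = ys"
      using G1.hurwitz_class[of u ys] u(1) assms(5,10) by simp
    \<comment> \<open>Since \<open>u\<close> fixes \<open>ys\<close> as well, the relation between
      its image and \<open>ys'\<close> holds for \<open>ys\<close> itself.\<close>
    then have "N_conj (ys ! i) (ys' ! i)"
      using u(3) i assms(5) by (simp add: list_all2_nthD)
    then show ?thesis by (simp add: N_conj_def)
  qed
  show ?thesis using \<pi> part1 part2 by blast
qed

end
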